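(* For every odd integer $k\ge 5$, the set $M=\{v_1^tv_7^t,\ v_2^tv_8^t,\ v_3^tv_4^t,\ v_5^tv_6^t : 1\le t\le k\}$ is a planarizing perfect matching of the Goldberg snark $G_k$; that is, $M$ is a perfect matching and $G_k/M$ is planar.
   Context: For a perfect matching $M$ of a graph $G$, $G/M$ is the (multi)graph obtained by contracting each edge of $M$ to a single vertex. For odd $k\ge 5$, the Goldberg snark $G_k$ has vertex set $\{v_j^t : 1\le t\le k,\ 1\le j\le 8\}$. For each $t$, the vertices $v_1^t,\dots,v_8^t$ induce a basic block with edges $v_1^tv_2^t,\ v_1^tv_7^t,\ v_2^tv_8^t,\ v_3^tv_4^t,\ v_3^tv_8^t,\ v_4^tv_7^t,\ v_5^tv_6^t,\ v_6^tv_7^t,\ v_6^tv_8^t$. In addition, for each $t$ there are edges $v_2^tv_1^{t+1},\ v_4^tv_3^{t+1},\ v_5^tv_5^{t+1}$, where superscripts are read modulo $k$. *)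

theory Defs
  imports "HOL-Analysis.Analysis"
begin

record 'a graph =
  vertices :: "'a set"
  edges :: "'a set set"

text \<open>In a multigraph the edges are labels; \<open>ends e\<close> is the set of end vertices of \<open>e\<close>,
  a singleton exactly when \<open>e\<close> is a loop.\<close>

record ('v, 'e) multigraph =
  nodes :: "'v set"
  links :: "'e set"
  ends :: "'e \<Rightarrow> 'v set"

definition perfect_matching :: "'a graph \<Rightarrow> 'a set set \<Rightarrow> bool" where
  "perfect_matching G M \<longleftrightarrow>
     M \<subseteq> edges G \<and> (\<forall>v \<in> vertices G. \<exists>!m. m \<in> M \<and> v \<in> m)"

text \<open>Contraction of a perfect matching \<open>M\<close>: each \<open>m \<in> M\<close> becomes a node, named \<open>m\<close> itself;
  the surviving edges keep their identity, so parallel edges are not merged.\<close>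

definition contract :: "'a graph \<Rightarrow> 'a set set \<Rightarrow> ('a set, 'a set) multigraph" where
  "contract G M =
     \<lparr>nodes = M, links = edges G - M, ends = (\<lambda>e. {m \<in> M. m \<inter> e \<noteq> {}})\<rparr>"

text \<open>A drawing without crossings in the Euclidean plane, here the type \<open>complex\<close>.
  A library \<open>simple_path\<close> may be closed, as a loop requires; for an edge with two distinct ends
  the conditions force \<open>\<gamma> e\<close> to be an arc.\<close>

definition plane_embedding ::
  "('v, 'e) multigraph \<Rightarrow> ('v \<Rightarrow> complex) \<Rightarrow> ('e \<Rightarrow> real \<Rightarrow> complex) \<Rightarrow> bool" where
  "plane_embedding H p \<gamma> \<longleftrightarrow>
     inj_on p (nodes H) \<and>
     (\<forall>e \<in> links H. simple_path (\<gamma> e) \<and>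
        {pathstart (\<gamma> e), pathfinish (\<gamma> e)} = p ` ends H e \<and>
        \<gamma> e ` {0<..<1} \<inter> p ` nodes H = {}) \<and>
     (\<forall>e \<in> links H. \<forall>f \<in> links H. e \<noteq> f \<longrightarrow> \<gamma> e ` {0<..<1} \<inter> \<gamma> f ` {0<..<1} = {})"

definition planar :: "('v, 'e) multigraph \<Rightarrow> bool" where
  "planar H \<longleftrightarrow> (\<exists>p \<gamma>. plane_embedding H p \<gamma>)"

definition planarizing_perfect_matching :: "'a graph \<Rightarrow> 'a set set \<Rightarrow> bool" where
  "planarizing_perfect_matching G M \<longleftrightarrow> perfect_matching G M \<and> planar (contract G M)"

text \<open>The pair \<open>(t, j)\<close> stands for $v_j^t$. For \<open>t \<in> {1..k}\<close>, the superscript $t+1$ read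
  modulo \<open>k\<close> within \<open>{1..k}\<close> is \<open>t mod k + 1\<close>.\<close>

definition goldberg_snark :: "nat \<Rightarrow> (nat \<times> nat) graph" where
  "goldberg_snark k =
     \<lparr>vertices = {1..k} \<times> {1..8},
      edges = (\<Union>t \<in> {1..k}.
        {{(t, 1), (t, 2)}, {(t, 1), (t, 7)}, {(t, 2), (t, 8)},
         {(t, 3), (t, 4)}, {(t, 3), (t, 8)}, {(t, 4), (t, 7)},
         {(t, 5), (t, 6)}, {(t, 6), (t, 7)}, {(t, 6), (t, 8)},
         {(t, 2), (t mod k + 1, 1)},
         {(t, 4), (t mod k + 1, 3)},
         {(t, 5), (t mod k + 1, 5)}})\<rparr>"

end

theory Submission
  imports Defs
begin

text \<open>Contracting \<open>M\<close> leaves, for each \<open>t\<close>, the four nodes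
  \<open>A = v\<^sub>1v\<^sub>7\<close>, \<open>B = v\<^sub>2v\<^sub>8\<close>, \<open>C = v\<^sub>3v\<^sub>4\<close>, \<open>D = v\<^sub>5v\<^sub>6\<close>. The nodes \<open>C\<close> form a cycle, so do the
  nodes \<open>D\<close>, and the nodes \<open>A\<close> and \<open>B\<close> form alternately a cycle between these two; the other edges
  join \<open>A\<close> and \<open>B\<close> to \<open>C\<close> and \<open>D\<close> of the same block. On a cylinder of circumference \<open>k\<close> this is
  drawn with straight segments, block \<open>t\<close> within the half-open strip \<open>t \<le> x < t + 1\<close> with
  \<open>A\<close>, \<open>B\<close>, \<open>C\<close>, \<open>D\<close> at offsets \<open>0\<close>, \<open>1/2\<close>, \<open>\<i>\<close>, \<open>-\<i>\<close>. The map \<open>z \<mapsto> exp (2\<pi>\<i>z/k)\<close> embeds the cylinder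
  in the plane.\<close>

section \<open>The exponential map from the cylinder to the plane\<close>

definition wrap :: "nat \<Rightarrow> complex \<Rightarrow> complex" where
  "wrap k z = exp (of_real (2 * pi / real k) * \<i> * z)"

text \<open>The period \<open>2 * pi * \<i>\<close> of \<open>exp\<close> becomes the real period
  \<open>k\<close> of \<open>wrap k\<close>.\<close>

lemma wrap_eq_iff:
  assumes "k > 0"
  shows "wrap k z = wrap k w \<longleftrightarrow> (\<exists>n::int. z = w + of_int (int k * n))"
proof -
  define c where "c = complex_of_real (2 * pi / real k) * \<i>"
  have "c \<noteq> 0"
    using assms by (simp add: c_def)
  have period: "(of_int (2 * n) * of_real pi) * \<i> = c * of_int (int k * n)" for n :: int
    using assms by (simp add: c_def)
  have "c * z = c * w + (of_int (2 * n) * of_real pi) * \<i> \<longleftrightarrow> z = w + of_int (int k * n)" for n :: int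
    unfolding period distrib_left[symmetric] using \<open>c \<noteq> 0\<close> by (simp only: mult_cancel_left simp_thms)
  then show ?thesis
    unfolding wrap_def c_def[symmetric] exp_eq by simp
qed

lemma wrap_inj_strip:
  assumes "wrap k z = wrap k w" "k > 0" "\<bar>Re z - Re w\<bar> < real k"
  shows "z = w"
proof -
  obtain n :: int where n: "z = w + of_int (int k * n)"
    using assms wrap_eq_iff by blast
  then have "real k * \<bar>real_of_int n\<bar> < real k * 1"
    using assms(3) by (simp add: abs_mult)
  then have "\<bar>real_of_int n\<bar> < 1"
    using assms(2) by (simp only: mult_less_cancel_left_pos of_nat_0_less_iff)
  then have "n = 0" by linarith
  then show ?thesis using n by simp
qed

text \<open>The half-open strips of blocks 1 to \<open>k\<close> tile exactly one period: both real
  parts lie in [1, k + 1), so they differ by less than \<open>k\<close>. Questions about crossings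
  in the plane thus reduce to a single block.\<close>

lemma wrap_inj_tile:
  assumes eq: "wrap k (of_nat t + a) = wrap k (of_nat s + b)"
    and ts: "t \<in> {1..k}" "s \<in> {1..k}"
    and ab: "0 \<le> Re a" "Re a < 1" "0 \<le> Re b" "Re b < 1"
  shows "t = s \<and> a = b"
proof -
  have "k > 0" using ts by auto
  have "real t \<ge> 1" "real s \<ge> 1" "real t \<le> real k" "real s \<le> real k"
    using ts by auto
  then have z: "of_nat t + a = of_nat s + b"
    using wrap_inj_strip[OF eq \<open>k > 0\<close>] ab by simp
  then have "real t + Re a = real s + Re b"
    by (metis plus_complex.sel(1) complex_Re_of_nat)
  then have "t = s" using ab by linarith
  then show ?thesis using z by simp
qed

lemma wrap_next:
  assumes "t \<in> {1..k}"
  shows "wrap k (of_nat (t mod k + 1) + a) = wrap k (of_nat t + (1 + a))"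
proof (cases "t = k")
  case True
  \<comment> \<open>The last block is followed by block 1, exactly one period back.\<close>
  have "of_nat t + (1 + a) = of_nat (t mod k + 1) + a + of_int (int k * 1)"
    using True by simp
  then show ?thesis
    using assms wrap_eq_iff[of k "of_nat t + (1 + a)"] by (metis atLeastAtMost_iff less_le_trans zero_less_one)
next
  case False
  then show ?thesis using assms by (simp add: add_ac)
qed

text \<open>A segment of width at most 1 is narrower than the period \<open>k\<close>, so wrapping
  cannot identify two of its points.\<close>

lemma arc_wrap_linepath:
  assumes "k > 1" "a \<noteq> b" "\<bar>Re a - Re b\<bar> \<le> 1"
  shows "arc (wrap k \<circ> linepath a b)"
  unfolding arc_def
proof
  show "path (wrap k \<circ> linepath a b)"
    unfolding path_def wrap_def o_def linepath_def by (intro continuous_intros)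
  show "inj_on (wrap k \<circ> linepath a b) {0..1}"
  proof (rule inj_onI)
    fix x y :: real
    assume xy: "x \<in> {0..1}" "y \<in> {0..1}"
      and eq: "(wrap k \<circ> linepath a b) x = (wrap k \<circ> linepath a b) y"
    have "Re (linepath a b x) - Re (linepath a b y) = (y - x) * (Re a - Re b)"
      by (simp add: linepath_def algebra_simps)
    also have "\<bar>\<dots>\<bar> \<le> 1 * 1"
      unfolding abs_mult using xy assms(3) by (intro mult_mono) auto
    finally have "\<bar>Re (linepath a b x) - Re (linepath a b y)\<bar> < real k"
      using assms(1) by simp
    moreover have "wrap k (linepath a b x) = wrap k (linepath a b y)" "k > 0"
      using eq assms(1) by simp_all
    ultimately have "linepath a b x = linepath a b y"
      using wrap_inj_strip by blast
    then show "x = y"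
      using inj_on_linepath[OF assms(2)] xy by (simp add: inj_on_eq_iff)
  qed
qed

section \<open>The perfect matching\<close>

definition goldberg_matching :: "nat \<Rightarrow> (nat \<times> nat) set set" where
  "goldberg_matching k =
    (\<Union>t \<in> {1..k}. {{(t, 1), (t, 7)}, {(t, 2), (t, 8)}, {(t, 3), (t, 4)}, {(t, 5), (t, 6)}})"

lemma matching_disjoint:
  assumes "m \<in> goldberg_matching k" "m' \<in> goldberg_matching k" "v \<in> m" "v \<in> m'"
  shows "m = m'"
  using assms unfolding goldberg_matching_def by auto

lemma perfect_matching_goldberg: "perfect_matching (goldberg_snark k) (goldberg_matching k)"
  unfolding perfect_matching_def
proof (intro conjI ballI)
  show "goldberg_matching k \<subseteq> edges (goldberg_snark k)"
    unfolding goldberg_matching_def goldberg_snark_def graph.simps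
    by (rule UN_mono[OF subset_refl]) (simp only: insert_subset insert_iff empty_subsetI simp_thms)
  fix v assume "v \<in> vertices (goldberg_snark k)"
  then obtain t j where v: "v = (t, j)" and t: "t \<in> {1..k}" and j: "j \<in> {1..8}"
    unfolding goldberg_snark_def by auto
  from j have "j \<in> {1, 2, 3, 4, 5, 6, 7, 8}" by auto
  then have "v \<in> {(t, 1), (t, 7)} \<union> {(t, 2), (t, 8)} \<union> {(t, 3), (t, 4)} \<union> {(t, 5), (t, 6)}"
    unfolding v by auto
  then have "\<exists>m. m \<in> goldberg_matching k \<and> v \<in> m"
    unfolding goldberg_matching_def using t by blast
  then show "\<exists>!m. m \<in> goldberg_matching k \<and> v \<in> m"
    using matching_disjoint by blast
qed

section \<open>Positions of the contracted nodes\<close>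

definition offset :: "nat \<Rightarrow> complex" where
  "offset j = (if j \<in> {1, 7} then 0 else if j \<in> {2, 8} then 1/2
               else if j \<in> {3, 4} then \<i> else - \<i>)"

definition place :: "nat \<times> nat \<Rightarrow> complex" where
  "place v = of_nat (fst v) + offset (snd v)"

text \<open>The choice is harmless: both ends of a matching edge have the same
  \<open>place\<close>.\<close>

definition node_point :: "nat \<Rightarrow> (nat \<times> nat) set \<Rightarrow> complex" where
  "node_point k m = wrap k (place (SOME v. v \<in> m))"

lemma place_matching_const:
  assumes "m \<in> goldberg_matching k" "u \<in> m" "v \<in> m"
  shows "place u = place v"
  using assms unfolding goldberg_matching_def by (auto simp: place_def offset_def)

lemma node_point_eq:
  assumes "m \<in> goldberg_matching k" "v \<in> m"
  shows "node_point k m = wrap k (place v)"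
  unfolding node_point_def using assms by (metis place_matching_const someI)

text \<open>The representatives 1, 2, 3, 5 of the four kinds of matching edge have pairwise distinct
  offsets, so a position determines its node.\<close>

lemma matching_cases:
  assumes "m \<in> goldberg_matching k"
  obtains t j where "t \<in> {1..k}" "j \<in> {1, 2, 3, 5}" "(t, j) \<in> m"
proof -
  obtain t where "t \<in> {1..k}"
    "m \<in> {{(t, 1), (t, 7)}, {(t, 2), (t, 8)}, {(t, 3), (t, 4)}, {(t, 5), (t, 6)}}"
    using assms unfolding goldberg_matching_def by blast
  then show thesis using that by blast
qed

lemma Re_offset: "0 \<le> Re (offset j)" "Re (offset j) < 1"
  by (auto simp: offset_def)

lemma inj_on_node_point: "inj_on (node_point k) (goldberg_matching k)"
proof (rule inj_onI)
  fix m m' assume m: "m \<in> goldberg_matching k" and m': "m' \<in> goldberg_matching k"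
    and eq: "node_point k m = node_point k m'"
  obtain t j where t: "t \<in> {1..k}" and j: "j \<in> {1, 2, 3, 5}" "(t, j) \<in> m"
    using m by (rule matching_cases)
  obtain s i where s: "s \<in> {1..k}" and i: "i \<in> {1, 2, 3, 5}" "(s, i) \<in> m'"
    using m' by (rule matching_cases)
  have "wrap k (of_nat t + offset j) = wrap k (of_nat s + offset i)"
    using eq node_point_eq[OF m j(2)] node_point_eq[OF m' i(2)] by (simp add: place_def)
  then have "t = s" and o: "offset j = offset i"
    using wrap_inj_tile[OF _ t s] Re_offset by blast+
  have "j = i"
    using o i(1) j(1) by (auto simp: offset_def complex_eq_iff)
  then show "m = m'" using matching_disjoint[OF m m' j(2)] i(2) \<open>t = s\<close> by simp
qed

section \<open>The remaining edges and their segments in one tile\<close>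

text \<open>A triple \<open>(i, j, d)\<close> encodes the edges from $v_i^t$ to $v_j^{t+d}$ outside the matching.\<close>

definition edge_types :: "(nat \<times> nat \<times> nat) set" where
  "edge_types = {(1, 2, 0), (2, 1, 1), (3, 8, 0), (4, 7, 0), (6, 7, 0), (6, 8, 0), (4, 3, 1), (5, 5, 1)}"

definition shift :: "nat \<Rightarrow> nat \<Rightarrow> nat \<Rightarrow> nat" where
  "shift k d t = (if d = 0 then t else t mod k + 1)"

definition snark_edge :: "nat \<Rightarrow> nat \<times> nat \<times> nat \<times> nat \<Rightarrow> (nat \<times> nat) set" where
  "snark_edge k = (\<lambda>(t, i, j, d). {(t, i), (shift k d t, j)})"

definition seg :: "nat \<times> nat \<times> nat \<Rightarrow> real \<Rightarrow> complex" where
  "seg = (\<lambda>(i, j, d). linepath (offset i) (of_nat d + offset j))"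

definition curve :: "nat \<Rightarrow> nat \<times> nat \<times> nat \<times> nat \<Rightarrow> real \<Rightarrow> complex" where
  "curve k = (\<lambda>(t, i, j, d).
     wrap k \<circ> linepath (of_nat t + offset i) (of_nat t + (of_nat d + offset j)))"

text \<open>Translation commutes with forming segments, so every block carries a copy of the same
  eight segments.\<close>

lemma curve_eq: "curve k (t, c) x = wrap k (of_nat t + seg c x)"
  by (cases c) (simp add: curve_def seg_def linepath_def algebra_simps)

lemma snark_edge_surj:
  "edges (goldberg_snark k) - goldberg_matching k \<subseteq> snark_edge k ` ({1..k} \<times> edge_types)"
proof
  fix e assume e: "e \<in> edges (goldberg_snark k) - goldberg_matching k"
  then obtain t where t: "t \<in> {1..k}" and edge:
    "e \<in> {{(t, 1), (t, 2)}, {(t, 1), (t, 7)}, {(t, 2), (t, 8)},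
         {(t, 3), (t, 4)}, {(t, 3), (t, 8)}, {(t, 4), (t, 7)},
         {(t, 5), (t, 6)}, {(t, 6), (t, 7)}, {(t, 6), (t, 8)},
         {(t, 2), (t mod k + 1, 1)}, {(t, 4), (t mod k + 1, 3)}, {(t, 5), (t mod k + 1, 5)}}"
    unfolding goldberg_snark_def graph.simps Diff_iff UN_iff by (elim conjE bexE)
  have "e \<notin> {{(t, 1), (t, 7)}, {(t, 2), (t, 8)}, {(t, 3), (t, 4)}, {(t, 5), (t, 6)}}"
    using e t unfolding goldberg_matching_def Diff_iff UN_iff by (elim conjE) (rule notI, erule notE, rule bexI)
  \<comment> \<open>These are the twelve edges of block \<open>t\<close> without its four matching
    edges; the rest is propositional.\<close>
  moreover have "snark_edge k ` Pair t ` edge_types =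
    {{(t, 1), (t, 2)}, {(t, 2), (t mod k + 1, 1)}, {(t, 3), (t, 8)}, {(t, 4), (t, 7)},
     {(t, 6), (t, 7)}, {(t, 6), (t, 8)}, {(t, 4), (t mod k + 1, 3)}, {(t, 5), (t mod k + 1, 5)}}"
    by (simp only: edge_types_def snark_edge_def shift_def image_insert image_empty split_conv
        if_True if_False zero_neq_one one_neq_zero refl)
  ultimately have "e \<in> snark_edge k ` Pair t ` edge_types"
    using edge by (simp only: insert_iff empty_iff) argo
  then show "e \<in> snark_edge k ` ({1..k} \<times> edge_types)" using t by blast
qed

text \<open>The right bound is strict because a segment into the next block reaches real part 1 only
  at its final parameter.\<close>

lemma Re_seg:
  assumes "c \<in> edge_types" "x \<in> {0<..<1}"
  shows "0 \<le> Re (seg c x)" "Re (seg c x) < 1"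
  using assms unfolding edge_types_def
  by (auto simp: field_simps seg_def linepath_def offset_def)

text \<open>Slanted segments have imaginary part strictly between the levels -1, 0, 1 of the nodes;
  horizontal ones run between consecutive nodes of their level.\<close>

lemma seg_neq_offset:
  assumes "c \<in> edge_types" "x \<in> {0<..<1}"
  shows "seg c x \<noteq> offset j"
  using assms unfolding edge_types_def
  by (auto simp: field_simps seg_def linepath_def offset_def complex_eq_iff)

text \<open>Imaginary parts separate the three levels and the two bands between them. The two pieces
  on level 0 meet only at 1/2, and the two slanted segments in a band only at their common end
  \<open>\<i>\<close> or \<open>- \<i>\<close>.\<close>

lemma seg_disjoint:
  assumes "c \<in> edge_types" "c' \<in> edge_types" "x \<in> {0<..<1}" "y \<in> {0<..<1}" "seg c x = seg c' y"
  shows "c = c'"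
  using assms unfolding edge_types_def
  by (auto simp: field_simps seg_def linepath_def offset_def complex_eq_iff)

section \<open>From the tile to the plane\<close>

lemma simple_path_curve:
  assumes "k > 1" "c \<in> edge_types"
  shows "simple_path (curve k (t, c))"
proof -
  obtain i j d where c: "c = (i, j, d)" by (cases c)
  have "offset i \<noteq> of_nat d + offset j" "\<bar>Re (offset i) - Re (of_nat d + offset j)\<bar> \<le> 1"
    using assms(2) unfolding c edge_types_def by (auto simp: offset_def complex_eq_iff)
  then show ?thesis
    unfolding curve_def c using assms(1) by (auto intro!: arc_imp_simple_path arc_wrap_linepath)
qed

lemma curve_ends:
  assumes "t \<in> {1..k}" "c \<in> edge_types"
  shows "{pathstart (curve k (t, c)), pathfinish (curve k (t, c))}
    = (\<lambda>v. wrap k (place v)) ` snark_edge k (t, c)"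
proof -
  obtain i j d where c: "c = (i, j, d)" by (cases c)
  have d: "d = 0 \<or> d = 1" using assms(2) unfolding c edge_types_def by auto
  have "pathstart (curve k (t, c)) = wrap k (place (t, i))"
    by (simp add: c curve_def place_def pathstart_compose)
  moreover have "pathfinish (curve k (t, c)) = wrap k (place (shift k d t, j))"
    using d wrap_next[OF assms(1), of "offset j"]
    by (auto simp: c curve_def place_def pathfinish_compose shift_def)
  ultimately show ?thesis by (simp add: c snark_edge_def)
qed

text \<open>Each vertex of \<open>e\<close> is covered by a matching edge, whose node is drawn at
  the wrapped place of that vertex.\<close>

lemma node_point_image_ends:
  assumes "e \<subseteq> vertices (goldberg_snark k)"
  shows "node_point k ` {m \<in> goldberg_matching k. m \<inter> e \<noteq> {}} = (\<lambda>v. wrap k (place v)) ` e"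
proof
  show "node_point k ` {m \<in> goldberg_matching k. m \<inter> e \<noteq> {}} \<subseteq> (\<lambda>v. wrap k (place v)) ` e"
    using node_point_eq by fastforce
  show "(\<lambda>v. wrap k (place v)) ` e \<subseteq> node_point k ` {m \<in> goldberg_matching k. m \<inter> e \<noteq> {}}"
  proof (rule image_subsetI)
    fix v assume "v \<in> e"
    then obtain m where "m \<in> goldberg_matching k" "v \<in> m"
      using assms perfect_matching_goldberg unfolding perfect_matching_def by blast
    then show "wrap k (place v) \<in> node_point k ` {m \<in> goldberg_matching k. m \<inter> e \<noteq> {}}"
      using node_point_eq \<open>v \<in> e\<close> by (intro image_eqI[of _ _ m]) auto
  qed
qed

lemma snark_edge_subset_vertices:
  assumes "t \<in> {1..k}" "c \<in> edge_types"
  shows "snark_edge k (t, c) \<subseteq> vertices (goldberg_snark k)"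
proof -
  have "t mod k + 1 \<in> {1..k}"
    using assms(1) by (simp add: Suc_le_eq)
  then show ?thesis
    using assms unfolding edge_types_def
    by (auto simp: snark_edge_def shift_def goldberg_snark_def)
qed

lemma curve_avoids_nodes:
  assumes "t \<in> {1..k}" "c \<in> edge_types"
  shows "curve k (t, c) ` {0<..<1} \<inter> node_point k ` goldberg_matching k = {}"
proof -
  have "curve k (t, c) x \<noteq> node_point k m" if x: "x \<in> {0<..<1}" and m: "m \<in> goldberg_matching k" for x m
  proof
    assume eq: "curve k (t, c) x = node_point k m"
    obtain s j where s: "s \<in> {1..k}" "(s, j) \<in> m"
      using m by (rule matching_cases)
    have "wrap k (of_nat t + seg c x) = wrap k (of_nat s + offset j)"
      using eq node_point_eq[OF m s(2)] by (simp add: curve_eq place_def)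
    then have "seg c x = offset j"
      using wrap_inj_tile[OF _ assms(1) s(1)] Re_seg[OF assms(2) x] Re_offset by blast
    then show False using seg_neq_offset[OF assms(2) x] by blast
  qed
  then show ?thesis by blast
qed

lemma curves_disjoint:
  assumes "t \<in> {1..k}" "c \<in> edge_types" "s \<in> {1..k}" "c' \<in> edge_types" "(t, c) \<noteq> (s, c')"
  shows "curve k (t, c) ` {0<..<1} \<inter> curve k (s, c') ` {0<..<1} = {}"
proof -
  have "curve k (t, c) x \<noteq> curve k (s, c') y" if x: "x \<in> {0<..<1}" and y: "y \<in> {0<..<1}" for x y
  proof
    assume "curve k (t, c) x = curve k (s, c') y"
    then have "wrap k (of_nat t + seg c x) = wrap k (of_nat s + seg c' y)"
      by (simp only: curve_eq)
    then have "t = s \<and> seg c x = seg c' y"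
      using wrap_inj_tile[OF _ assms(1) assms(3)] Re_seg[OF assms(2) x] Re_seg[OF assms(4) y] by blast
    then show False using seg_disjoint[OF assms(2,4) x y] assms(5) by blast
  qed
  then show ?thesis by blast
qed

section \<open>Assembling the plane embedding\<close>

lemma planar_contract_goldberg:
  assumes "k > 1"
  shows "planar (contract (goldberg_snark k) (goldberg_matching k))"
proof -
  let ?H = "contract (goldberg_snark k) (goldberg_matching k)"
  \<comment> \<open>Picks for each surviving edge one block and type that produce it; these select
    its curve.\<close>
  define idx where "idx = inv_into ({1..k} \<times> edge_types) (snark_edge k)"
  have idx: "\<exists>t c. idx e = (t, c) \<and> t \<in> {1..k} \<and> c \<in> edge_types \<and> e = snark_edge k (t, c)"
    if "e \<in> links ?H" for e
  proof -
    have e: "e \<in> snark_edge k ` ({1..k} \<times> edge_types)"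
      using that snark_edge_surj[of k] by (auto simp: contract_def)
    have "idx e \<in> {1..k} \<times> edge_types" "snark_edge k (idx e) = e"
      unfolding idx_def using inv_into_into[OF e] f_inv_into_f[OF e] by blast+
    then show ?thesis by (cases "idx e") auto
  qed
  have "plane_embedding ?H (node_point k) (\<lambda>e. curve k (idx e))"
    unfolding plane_embedding_def
  proof (intro conjI ballI impI)
    show "inj_on (node_point k) (nodes ?H)"
      using inj_on_node_point by (simp add: contract_def)
  next
    fix e assume "e \<in> links ?H"
    then obtain t c where *: "idx e = (t, c)" "t \<in> {1..k}" "c \<in> edge_types" "e = snark_edge k (t, c)"
      using idx by blast
    show "simple_path (curve k (idx e))"
      using * assms simple_path_curve by simp
    show "{pathstart (curve k (idx e)), pathfinish (curve k (idx e))} = node_point k ` ends ?H e"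
      using * curve_ends node_point_image_ends[OF snark_edge_subset_vertices]
      by (simp add: contract_def)
    show "curve k (idx e) ` {0<..<1} \<inter> node_point k ` nodes ?H = {}"
      using * curve_avoids_nodes by (simp add: contract_def)
  next
    fix e f assume e: "e \<in> links ?H" and f: "f \<in> links ?H" and "e \<noteq> f"
    obtain t c where 1: "idx e = (t, c)" "t \<in> {1..k}" "c \<in> edge_types" "e = snark_edge k (t, c)"
      using idx[OF e] by blast
    obtain s c' where 2: "idx f = (s, c')" "s \<in> {1..k}" "c' \<in> edge_types" "f = snark_edge k (s, c')"
      using idx[OF f] by blast
    \<comment> \<open>An edge is recovered from its index by \<open>snark_edge\<close>, so distinct
      edges have distinct indices.\<close>
    have "(t, c) \<noteq> (s, c')"
      using \<open>e \<noteq> f\<close> 1(4) 2(4) by metis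
    then show "curve k (idx e) ` {0<..<1} \<inter> curve k (idx f) ` {0<..<1} = {}"
      unfolding 1(1) 2(1) using 1 2 by (intro curves_disjoint)
  qed
  then show ?thesis unfolding planar_def by blast
qed

theorem mainTheorem4:
  fixes k :: nat
  assumes "odd k" and "k \<ge> 5"
  shows "planarizing_perfect_matching (goldberg_snark k)
    (\<Union>t \<in> {1..k}. {{(t, 1), (t, 7)}, {(t, 2), (t, 8)}, {(t, 3), (t, 4)}, {(t, 5), (t, 6)}})"
  using perfect_matching_goldberg[of k] planar_contract_goldberg[of k] assms(2)
  unfolding planarizing_perfect_matching_def goldberg_matching_def by simp

end
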